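(* Let $G=(V,E)$ be a graph, let $X$ be a reconfiguration monotone increasing property of vertex sets of $G$, and let $A_s,A_t\subseteq V$ have property $X$ with $|A_s|=|A_t|=k$. Then there exists an $X$-TJ sequence from $A_s$ to $A_t$ of length at most $\ell$ if and only if there exists an $X$-TAR sequence from $A_s$ to $A_t$ with threshold $k+1$ of length at most $2\ell$.
   Context: For $A,B\subseteq V$: $B$ is obtained from $A$ by a token jumping (TJ) step if $|A|=|B|$ and $|A\setminus B|=1$; by a token addition/removal (TAR) step if one of $A,B$ is obtained from the other by adding exactly one vertex. For a property $X$ of vertex sets and $Y\in\{\text{TJ},\text{TAR}\}$, an $X$-$Y$ sequence from $A$ to $B$ is a sequence $A=A_1,\dots,A_m=B$ of sets with property $X$ such that each $A_{i+1}$ is obtained from $A_i$ by a $Y$ step; its length is $m$. A TAR sequence has threshold $t$ if $|A_i|\le t$ for all $i$. A property $X$ is reconfiguration monotone increasing if for all $A,B$ with property $X$ such that $B$ is obtained from $A$ by a TJ step, and $v\in B\setminus A$, the set $A\cup\{v\}$ also has property $X$. *)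

theory Defs
  imports "Graph_Theory.Digraph"
begin

text \<open>
  \<^const>\<open>graph\<close> is the library's notion of a finite simple undirected graph (a finite symmetric
  digraph without loops or parallel arcs). In particular all vertex sets below are finite, so
  \<^const>\<open>card\<close> is the true cardinality. A property of vertex sets is a predicate, of which
  only the values on subsets of \<^term>\<open>verts G\<close> matter.
\<close>

definition tj_step :: "'a set \<Rightarrow> 'a set \<Rightarrow> bool" where
  "tj_step A B \<longleftrightarrow> card A = card B \<and> card (A - B) = 1"

definition tar_step :: "'a set \<Rightarrow> 'a set \<Rightarrow> bool" where
  "tar_step A B \<longleftrightarrow> (\<exists>v. v \<notin> A \<and> B = insert v A) \<or> (\<exists>v. v \<notin> B \<and> A = insert v B)"

text \<open>
  The length of a sequence is the number of its sets, not the number of its steps. The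
  one-element sequence is a sequence from a set to itself.
\<close>

definition reconf_sequence ::
  "('a, 'b) pre_digraph \<Rightarrow> ('a set \<Rightarrow> bool) \<Rightarrow> ('a set \<Rightarrow> 'a set \<Rightarrow> bool)
    \<Rightarrow> 'a set \<Rightarrow> 'a set \<Rightarrow> 'a set list \<Rightarrow> bool" where
  "reconf_sequence G X step A B As \<longleftrightarrow>
     As \<noteq> [] \<and> hd As = A \<and> last As = B
     \<and> (\<forall>S \<in> set As. S \<subseteq> verts G \<and> X S) \<and> successively step As"

definition has_threshold :: "nat \<Rightarrow> 'a set list \<Rightarrow> bool" where
  "has_threshold t As \<longleftrightarrow> (\<forall>S \<in> set As. card S \<le> t)"

definition reconf_monotone_increasing ::
  "('a, 'b) pre_digraph \<Rightarrow> ('a set \<Rightarrow> bool) \<Rightarrow> bool" where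
  "reconf_monotone_increasing G X \<longleftrightarrow>
     (\<forall>A B v. A \<subseteq> verts G \<longrightarrow> B \<subseteq> verts G \<longrightarrow> X A \<longrightarrow> X B \<longrightarrow> tj_step A B \<longrightarrow> v \<in> B - A
        \<longrightarrow> X (A \<union> {v}))"

end

theory Submission
  imports Defs
begin

text \<open>
  A TJ step \<open>A \<rightarrow> B\<close> is replaced by the two TAR steps \<open>A \<rightarrow> A \<union> B \<rightarrow> B\<close>. Conversely, if a TAR
  sequence between sets of size \<open>k\<close> visits a set of size below \<open>k\<close>, let \<open>S\<close> be a smallest set
  in it; its two neighbours are \<open>S \<union> {u}\<close> and \<open>S \<union> {v}\<close>. If \<open>u = v\<close> the detour through \<open>S\<close> is cut out,
  and otherwise the neighbours differ by a TJ step, so that \<open>S \<union> {u, v}\<close> has the property and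
  replaces \<open>S\<close>. Both operations decrease the total deficiency \<open>\<Sum>(k + 1 - |A\<^sub>i|)\<close>. In the end all
  sizes are \<open>k\<close> or \<open>k + 1\<close>, and the sets of size \<open>k\<close> form a TJ sequence after removing repetitions.
\<close>

lemma reconf_sequence_singleton [simp]:
  "reconf_sequence G X step A B [C] \<longleftrightarrow> C = A \<and> C = B \<and> C \<subseteq> verts G \<and> X C"
  by (auto simp: reconf_sequence_def)

lemma reconf_sequence_Cons_Cons [simp]:
  "reconf_sequence G X step A B (C # D # As) \<longleftrightarrow>
     C = A \<and> C \<subseteq> verts G \<and> X C \<and> step C D \<and> reconf_sequence G X step D B (D # As)"
  by (auto simp: reconf_sequence_def)

lemma reconf_sequence_ConsD:
  "reconf_sequence G X step A B As \<Longrightarrow> \<exists>As'. As = A # As'"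
  by (cases As) (auto simp: reconf_sequence_def)

lemma tj_stepE:
  assumes "tj_step A B" "finite A" "finite B"
  obtains u v where "u \<in> A - B" "v \<in> B - A" "insert v A = insert u B"
proof -
  have "card (B - A) = 1" "card (A - B) = 1"
    using assms card_le_sym_Diff[of A B] card_le_sym_Diff[of B A] by (auto simp: tj_step_def)
  then obtain u v where "A - B = {u}" "B - A = {v}"
    by (auto simp: card_1_singleton_iff)
  then show thesis
    by (intro that[of u v]) auto
qed

lemma tj_step_insert:
  assumes "finite S" "u \<notin> S" "v \<notin> S" "u \<noteq> v"
  shows "tj_step (insert u S) (insert v S)"
proof -
  have "insert u S - insert v S = {u}"
    using assms by auto
  then show ?thesis
    using assms by (simp add: tj_step_def)
qed

text \<open>Deleting \<open>u\<close> and \<open>v\<close> respectively from the common superset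
  leaves \<open>A \<inter> B\<close> plus one vertex on either side. So an addition followed by a
  removal amounts to one TJ step unless it returns to \<open>A\<close>.\<close>

lemma tj_step_common_superset:
  assumes "finite A" "u \<notin> A" "v \<notin> B" "insert u A = insert v B" "A \<noteq> B"
  shows "tj_step A B"
proof -
  have "u \<noteq> v"
    using assms by auto
  then have "A = insert v (A \<inter> B)" "B = insert u (A \<inter> B)"
    using assms by auto
  with tj_step_insert[of "A \<inter> B" v u] assms \<open>u \<noteq> v\<close> show ?thesis
    by auto
qed

text \<open>A TAR step changes the size by exactly one, so comparing cardinalities reveals its
  direction.\<close>

lemma tar_step_le_cardE:
  assumes "tar_step A B" "finite A" "finite B" "card A \<le> card B"
  obtains v where "v \<notin> A" "B = insert v A"
  using assms by (auto simp: tar_step_def)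

lemma tar_step_sym: "tar_step A B \<longleftrightarrow> tar_step B A"
  by (auto simp: tar_step_def)

text \<open>Inserting the union between consecutive sets turns n sets into 2n - 1, hence the strict
  bound. Each union has k + 1 elements, which is exactly the threshold.\<close>

lemma tar_sequence_of_tj_sequence:
  assumes fin: "finite (verts G)"
    and mono: "reconf_monotone_increasing G X"
  shows "reconf_sequence G X tj_step A B As \<Longrightarrow> card A = k \<Longrightarrow>
    \<exists>Bs. reconf_sequence G X tar_step A B Bs \<and> has_threshold (k + 1) Bs
       \<and> length Bs < 2 * length As"
proof (induction As arbitrary: A rule: induct_list012)
  case 1
  then show ?case by (simp add: reconf_sequence_def)
next
  case (2 C)
  then show ?case
    by (intro exI[of _ "[C]"]) (auto simp: has_threshold_def)
next
  case (3 C D As)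
  then have C: "C = A" "A \<subseteq> verts G" "X A" "tj_step A D"
    and seq: "reconf_sequence G X tj_step D B (D # As)"
    by auto
  have D: "D \<subseteq> verts G" "X D"
    using seq by (auto simp: reconf_sequence_def)
  have card_D: "card D = k"
    using C 3 by (simp add: tj_step_def)
  obtain Bs where Bs: "reconf_sequence G X tar_step D B Bs" "has_threshold (k + 1) Bs"
      "length Bs < 2 * length (D # As)"
    using "3.IH"(2)[OF seq card_D] by blast
  obtain Bs' where Bs': "Bs = D # Bs'"
    using reconf_sequence_ConsD[OF Bs(1)] by blast
  have finite_AD: "finite A" "finite D"
    using C D fin finite_subset by auto
  then obtain u v where uv: "u \<in> A - D" "v \<in> D - A" "insert v A = insert u D"
    using tj_stepE[OF C(4)] by blast
  have "X (insert v A)"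
    using mono C D uv(2) unfolding reconf_monotone_increasing_def by fastforce
  moreover have "tar_step A (insert v A)" "tar_step (insert v A) D"
    using uv by (auto simp: tar_step_def)
  ultimately show ?case
    using Bs Bs' C D card_D uv finite_AD "3.prems"
    by (intro exI[of _ "A # insert v A # Bs"]) (auto simp: has_threshold_def)
qed

text \<open>The sizes alternate between k and k + 1, so the induction consumes two sets at a time.
  There is one more set of size k than of size k + 1, whence the \<open>+ 1\<close> in the
  bound.\<close>

lemma tj_sequence_of_two_level_tar_sequence:
  assumes fin: "finite (verts G)"
    and card_B: "card B = k"
  shows "reconf_sequence G X tar_step A B As \<Longrightarrow> card A = k \<Longrightarrow> \<forall>S\<in>set As. k \<le> card S \<Longrightarrow>
    has_threshold (k + 1) As \<Longrightarrow>
    \<exists>Bs. reconf_sequence G X tj_step A B Bs \<and> 2 * length Bs \<le> length As + 1"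
proof (induction As arbitrary: A rule: induct_list012)
  case 1
  then show ?case by (simp add: reconf_sequence_def)
next
  case (2 C)
  then show ?case
    by (intro exI[of _ "[C]"]) auto
next
  case (3 C P As)
  then have C: "C = A" "A \<subseteq> verts G" "X A" "tar_step A P"
    and seq: "reconf_sequence G X tar_step P B (P # As)"
    by auto
  have P: "P \<subseteq> verts G" "k \<le> card P"
    using seq 3 by (auto simp: reconf_sequence_def)
  obtain u where u: "u \<notin> A" "P = insert u A"
    using tar_step_le_cardE[OF C(4)] P C fin "3.prems" finite_subset by metis
  have card_P: "card P = Suc k"
    using u C fin "3.prems" finite_subset by (metis card_insert_disjoint)
  \<comment> \<open>\<open>P\<close> has size k + 1 but \<open>B\<close> has size k, so the sequence
    cannot end at \<open>P\<close>.\<close>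
  then obtain D As' where As: "As = D # As'"
    using seq card_B by (cases As) auto
  then have D: "D \<subseteq> verts G" "X D" "tar_step P D" "k \<le> card D" "card D \<le> k + 1"
    and seq': "reconf_sequence G X tar_step D B As"
    using seq "3.prems" by (auto simp: reconf_sequence_def has_threshold_def)
  have fin_D: "finite D" "finite P" "finite A"
    using D P C fin finite_subset by auto
  obtain v where v: "v \<notin> D" "P = insert v D"
    using tar_step_le_cardE[of D P] D fin_D card_P tar_step_sym by (metis Suc_eq_plus1)
  then have card_D: "card D = k"
    using card_P fin_D by simp
  obtain Bs where Bs: "reconf_sequence G X tj_step D B Bs" "2 * length Bs \<le> length As + 1"
    using "3.IH"(1)[OF seq' card_D] "3.prems" by (auto simp: has_threshold_def)
  obtain Bs' where Bs': "Bs = D # Bs'"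
    using reconf_sequence_ConsD[OF Bs(1)] by blast
  show ?case
  proof (cases "A = D")
    \<comment> \<open>The added vertex was removed again: the sequence from \<open>D\<close> already
      starts at \<open>A\<close>.\<close>
    case True
    then show ?thesis using Bs by auto
  next
    case False
    then have "tj_step A D"
      using tj_step_common_superset u v fin_D by metis
    then show ?thesis
      using Bs Bs' C by (intro exI[of _ "A # Bs"]) auto
  qed
qed

text \<open>A set of minimum size is no larger than its neighbours, so each neighbour must arise
  from it by adding a vertex.\<close>

lemma tar_sequence_valley:
  assumes fin: "finite (verts G)"
    and seq: "reconf_sequence G X tar_step A B As"
    and "card A = k" "card B = k" "T \<in> set As" "card T < k"
  obtains xs S u v ys where "As = xs @ insert u S # S # insert v S # ys"
    "u \<notin> S" "v \<notin> S" "card S < k"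
proof -
  obtain S where S: "S \<in> set As" "\<forall>R\<in>set As. card S \<le> card R"
    using ex_min_if_finite[of "card ` set As"] \<open>T \<in> set As\<close>
    by (metis List.finite_set arg_min_if_finite(1,2) empty_iff linorder_not_less)
  with \<open>T \<in> set As\<close> \<open>card T < k\<close> have card_S: "card S < k"
    by fastforce
  obtain ws zs where As: "As = ws @ S # zs"
    using S by (meson split_list)
  \<comment> \<open>Both ends have size k and \<open>S\<close> is smaller, so \<open>S\<close> is an
    interior member.\<close>
  have "ws \<noteq> []" "zs \<noteq> []"
    using As seq assms card_S by (auto simp: reconf_sequence_def)
  then obtain xs P Q ys where "ws = xs @ [P]" "zs = Q # ys"
    by (metis list.exhaust rev_exhaust)
  with As have As: "As = xs @ P # S # Q # ys"
    by simp
  then have steps: "tar_step S P" "tar_step S Q"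
    and sub: "P \<subseteq> verts G" "S \<subseteq> verts G" "Q \<subseteq> verts G"
    using seq tar_step_sym by (auto simp: reconf_sequence_def successively_append_iff)
  have le: "card S \<le> card P" "card S \<le> card Q"
    using S As by auto
  obtain u where "u \<notin> S" "P = insert u S"
    using tar_step_le_cardE steps sub le fin finite_subset by metis
  moreover obtain v where "v \<notin> S" "Q = insert v S"
    using tar_step_le_cardE steps sub le fin finite_subset by metis
  ultimately show thesis
    using that As card_S by blast
qed

text \<open>Neither replacement lengthens the sequence, so the length bound of the two-level case
  carries over.\<close>

lemma tj_sequence_of_tar_sequence:
  assumes fin: "finite (verts G)"
    and mono: "reconf_monotone_increasing G X"
    and card_A: "card A = k"
    and card_B: "card B = k"
  shows "reconf_sequence G X tar_step A B As \<Longrightarrow> has_threshold (k + 1) As \<Longrightarrow>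
    \<exists>Bs. reconf_sequence G X tj_step A B Bs \<and> 2 * length Bs \<le> length As + 1"
proof (induction "\<Sum>S\<leftarrow>As. k + 1 - card S" arbitrary: As rule: less_induct)
  case less
  show ?case
  proof (cases "\<forall>S\<in>set As. k \<le> card S")
    case True
    then show ?thesis
      using tj_sequence_of_two_level_tar_sequence[OF fin card_B] less.prems card_A by blast
  next
    case False
    then obtain T where T: "T \<in> set As" "card T < k"
      by auto
    obtain xs S u v ys where As: "As = xs @ insert u S # S # insert v S # ys"
      and uv: "u \<notin> S" "v \<notin> S" and card_S: "card S < k"
      by (rule tar_sequence_valley[OF fin less.prems(1) card_A card_B T])
    have sub: "insert u S \<subseteq> verts G" "insert v S \<subseteq> verts G" "X (insert u S)" "X (insert v S)"
      using less.prems As by (auto simp: reconf_sequence_def)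
    then have fin_S: "finite S"
      using fin finite_subset by auto
    define As' where "As' = (if u = v then xs @ insert u S # ys
      else xs @ insert u S # insert v (insert u S) # insert v S # ys)"
    have "X (insert v (insert u S))" if "u \<noteq> v"
    proof -
      have "tj_step (insert u S) (insert v S)"
        using tj_step_insert fin_S uv that by metis
      then have "X (insert u S \<union> {v})"
        using mono sub uv that unfolding reconf_monotone_increasing_def by blast
      then show ?thesis by simp
    qed
    moreover have "tar_step (insert u S) (insert v (insert u S))"
        "tar_step (insert v (insert u S)) (insert v S)" if "u \<noteq> v"
      using uv that by (auto simp: tar_step_def)
    \<comment> \<open>If \<open>u = v\<close>, the step from \<open>insert v S\<close> into
      \<open>ys\<close> now starts at the equal set \<open>insert u S\<close>.\<close>
    ultimately have "successively tar_step As'" "\<forall>S\<in>set As'. S \<subseteq> verts G \<and> X S"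
      using less.prems(1) sub unfolding As As'_def reconf_sequence_def
      by (cases ys; auto simp: successively_append_iff)+
    moreover have "As' \<noteq> []" "hd As' = hd As" "last As' = last As"
      by (cases xs; auto simp: As As'_def)+
    ultimately have "reconf_sequence G X tar_step A B As'"
      using less.prems(1) by (simp add: reconf_sequence_def)
    \<comment> \<open>\<open>card S < k\<close> leaves room for two more vertices: the new set has
      \<open>card S + 2 \<le> k + 1\<close> elements.\<close>
    moreover have "has_threshold (k + 1) As'"
      using less.prems(2) card_S uv fin_S by (auto simp: As As'_def has_threshold_def)
    \<comment> \<open>If \<open>u = v\<close>, two summands disappear, that of \<open>S\<close>
      being positive; otherwise the summand of \<open>S\<close> drops by 2.\<close>
    moreover have "(\<Sum>S\<leftarrow>As'. k + 1 - card S) < (\<Sum>S\<leftarrow>As. k + 1 - card S)"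
      using card_S uv fin_S by (auto simp: As As'_def)
    ultimately obtain Bs where
      "reconf_sequence G X tj_step A B Bs" "2 * length Bs \<le> length As' + 1"
      using less.hyps by blast
    moreover have "length As' \<le> length As"
      by (simp add: As As'_def)
    ultimately show ?thesis by fastforce
  qed
qed

theorem theorem3:
  fixes G :: "('a, 'b) pre_digraph"
    and X :: "'a set \<Rightarrow> bool"
    and A\<^sub>s A\<^sub>t :: "'a set"
    and k l :: nat
  assumes "graph G"
    and "reconf_monotone_increasing G X"
    and "A\<^sub>s \<subseteq> verts G" and "A\<^sub>t \<subseteq> verts G"
    and "X A\<^sub>s" and "X A\<^sub>t"
    and "card A\<^sub>s = k" and "card A\<^sub>t = k"
  shows "(\<exists>As. reconf_sequence G X tj_step A\<^sub>s A\<^sub>t As \<and> length As \<le> l) \<longleftrightarrow>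
         (\<exists>As. reconf_sequence G X tar_step A\<^sub>s A\<^sub>t As \<and> has_threshold (k + 1) As
               \<and> length As \<le> 2 * l)"
proof -
  interpret graph G by fact
  have fin: "finite (verts G)" by simp
  show ?thesis (is "?tj \<longleftrightarrow> ?tar")
  proof
    assume ?tj
    then obtain As where "reconf_sequence G X tj_step A\<^sub>s A\<^sub>t As" "length As \<le> l"
      by blast
    with tar_sequence_of_tj_sequence[OF fin assms(2) _ assms(7)] show ?tar
      by fastforce
  next
    assume ?tar
    then obtain As where As: "reconf_sequence G X tar_step A\<^sub>s A\<^sub>t As" "has_threshold (k + 1) As"
        "length As \<le> 2 * l"
      by blast
    from tj_sequence_of_tar_sequence[OF fin assms(2,7,8) As(1,2)]
    obtain Bs where Bs: "reconf_sequence G X tj_step A\<^sub>s A\<^sub>t Bs" "2 * length Bs \<le> length As + 1"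
      by blast
    \<comment> \<open>Here \<open>2 * length Bs \<le> 2 * l + 1\<close>, and the surplus 1 is lost
      by parity.\<close>
    with As(3) have "length Bs \<le> l"
      by simp
    with Bs(1) show ?tj by blast
  qed
qed

end
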